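(* Let $I,J$ be finite sets, $\omega:\mathbb{R}^I\to\mathbb{R}^I$ a nonsingular linear map, $\Lambda:\mathbb{R}^J\to\mathbb{R}^I$ a linear injection, $\iota:\mathbb{R}^J\to\mathbb{R}^J$ a linear bijection and $\vartheta:\mathbb{R}^J\to\mathbb{R}^J$ a symmetric positive definite linear map. On $\mathbb{R}^J\oplus\mathbb{R}^I\oplus\mathbb{R}^I$ define $$A=\begin{pmatrix}-\tfrac12\iota\iota^* & -\Lambda^* & 0\\ \Lambda & 0 & -\omega^*\\ 0 & \omega & 0\end{pmatrix},\qquad B=\begin{pmatrix}\iota\\0\\0\end{pmatrix}\vartheta^{1/2}.$$ If the pair $(\omega^*\omega,\Lambda)$ satisfies the Kalman condition, then the pair $(A,B)$ satisfies the Kalman condition.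
   Context: A pair $(M,N)$ of linear maps $M:\mathbb{R}^m\to\mathbb{R}^m$, $N:\mathbb{R}^k\to\mathbb{R}^m$ satisfies the Kalman condition if the ranges of $N, MN, M^2N, \dots$ together span $\mathbb{R}^m$. Stars denote transposes (adjoints for the standard inner products). *)

theory Defs
  imports "HOL-Analysis.Analysis"
begin

text \<open>Kalman condition for a pair (M,N), M an m x m matrix, N an m x k matrix
  (acting on column vectors via *v): the ranges of N, MN, M^2 N, ... span the whole space.\<close>
definition kalman :: "real^'m^'m \<Rightarrow> real^'k^'m \<Rightarrow> bool" where
  "kalman M N \<longleftrightarrow>
     span (\<Union>k. range ((((*v) M) ^^ k) \<circ> ((*v) N))) = UNIV"

text \<open>Symmetric positive definite matrices.\<close>
definition sym_posdef :: "real^'n^'n \<Rightarrow> bool" where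
  "sym_posdef T \<longleftrightarrow> transpose T = T \<and> (\<forall>x. x \<noteq> 0 \<longrightarrow> x \<bullet> (T *v x) > 0)"

text \<open>The block operator A on R^J (+) R^I (+) R^I, with index type ('j + 'i) + 'i:
  Inl (Inl _) = first R^J block, Inl (Inr _) = first R^I block, Inr _ = second R^I block.\<close>
definition blockA :: "real^'i^'i \<Rightarrow> real^'j^'i \<Rightarrow> real^'j^'j \<Rightarrow> real^(('j + 'i) + 'i)^(('j + 'i) + 'i)" where
  "blockA \<omega> \<Lambda> \<iota> = (\<chi> r c.
     (case r of
        Inl (Inl a) \<Rightarrow> (case c of
            Inl (Inl b) \<Rightarrow> - (1/2) * ((\<iota> ** transpose \<iota>) $ a $ b)
          | Inl (Inr b) \<Rightarrow> - (transpose \<Lambda> $ a $ b)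
          | Inr b \<Rightarrow> 0)
      | Inl (Inr a) \<Rightarrow> (case c of
            Inl (Inl b) \<Rightarrow> \<Lambda> $ a $ b
          | Inl (Inr b) \<Rightarrow> 0
          | Inr b \<Rightarrow> - (transpose \<omega> $ a $ b))
      | Inr a \<Rightarrow> (case c of
            Inl (Inl b) \<Rightarrow> 0
          | Inl (Inr b) \<Rightarrow> \<omega> $ a $ b
          | Inr b \<Rightarrow> 0)))"

text \<open>The block operator B = (iota; 0; 0) S, where S is the square root of theta.\<close>
definition blockB :: "real^'j^'j \<Rightarrow> real^'j^'j \<Rightarrow> real^'j^(('j::finite + 'i::finite) + 'i)" where
  "blockB \<iota> S = (\<chi> r c. (case r of Inl (Inl a) \<Rightarrow> (\<iota> ** S) $ a $ c | _ \<Rightarrow> 0))"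

end

theory Submission
  imports Defs
begin

text \<open>The reachable space of (A,B) is the smallest A-invariant subspace containing the range
  of B. Since \<iota> S is invertible, it contains the whole first block. Modulo the first block, A
  moves y in the second block to \<omega>y in the third, and A moves a vector z in the third block to
  -\<omega>^*z in the second. So the y whose second-block copy is reachable form an
  \<omega>^*\<omega>-invariant subspace; it contains the range of \<Lambda> (apply A to the first block), hence
  is everything by the Kalman condition for (\<omega>^*\<omega>,\<Lambda>), and invertibility of \<omega> then gives
  the third block.\<close>

lemma kalman_iff_invariant_subspaces:
  fixes M :: "real^'m^'m" and N :: "real^'k^'m"
  shows "kalman M N \<longleftrightarrow>
    (\<forall>V. subspace V \<and> range ((*v) N) \<subseteq> V \<and> (*v) M ` V \<subseteq> V \<longrightarrow> V = UNIV)"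
proof -
  define G where "G = (\<Union>k. range ((((*v) M) ^^ k) \<circ> ((*v) N)))"
  have G_in: "G \<subseteq> V" if "range ((*v) N) \<subseteq> V" "(*v) M ` V \<subseteq> V" for V
  proof -
    have "(((*v) M) ^^ k) (N *v x) \<in> V" for k x
      using that by (induction k) auto
    then show ?thesis unfolding G_def by auto
  qed
  have range_N: "range ((*v) N) \<subseteq> span G"
  proof
    fix y assume "y \<in> range ((*v) N)"
    then have "y \<in> G" unfolding G_def by (auto intro!: exI[of _ 0])
    then show "y \<in> span G" by (rule span_base)
  qed
  have M_G: "(*v) M ` G \<subseteq> G"
  proof
    fix z assume "z \<in> (*v) M ` G"
    then obtain k x where "z = ((((*v) M) ^^ Suc k) \<circ> ((*v) N)) x" unfolding G_def by auto
    then show "z \<in> G" unfolding G_def by blast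
  qed
  have "(*v) M ` span G \<subseteq> span G"
    using M_G by (metis span_linear_image matrix_vector_mul_linear span_mono)
  then show ?thesis
    unfolding kalman_def G_def[symmetric]
    using range_N G_in by (metis span_minimal subset_antisym subset_UNIV subspace_span)
qed

lemma sym_posdef_invertible:
  fixes T :: "real^'n^'n"
  assumes "sym_posdef T"
  shows "invertible T"
proof -
  have "x = 0" if "T *v x = 0" for x
    using assms that unfolding sym_posdef_def by force
  then show ?thesis
    by (simp add: invertible_left_inverse matrix_left_invertible_ker)
qed

lemma invertible_imp_surj:
  fixes T :: "real^'n^'n"
  assumes "invertible T"
  shows "surj ((*v) T)"
  using assms by (metis invertible_right_inverse matrix_right_invertible_surjective)

definition in_block1 :: "real^'j \<Rightarrow> real^(('j::finite + 'i::finite) + 'i)" where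
  "in_block1 x = (\<chi> r. case r of Inl (Inl a) \<Rightarrow> x $ a | _ \<Rightarrow> 0)"

definition in_block2 :: "real^'i \<Rightarrow> real^(('j::finite + 'i::finite) + 'i)" where
  "in_block2 y = (\<chi> r. case r of Inl (Inr a) \<Rightarrow> y $ a | _ \<Rightarrow> 0)"

definition in_block3 :: "real^'i \<Rightarrow> real^(('j::finite + 'i::finite) + 'i)" where
  "in_block3 y = (\<chi> r. case r of Inr a \<Rightarrow> y $ a | _ \<Rightarrow> 0)"

lemma linear_in_block2: "linear in_block2"
  by (rule linearI) (auto simp: vec_eq_iff in_block2_def split: sum.split)

lemma block_decomposition:
  "(v :: real^(('j::finite + 'i::finite) + 'i)) =
     in_block1 (\<chi> a. v $ Inl (Inl a)) + in_block2 (\<chi> a. v $ Inl (Inr a)) + in_block3 (\<chi> a. v $ Inr a)"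
  by (auto simp: vec_eq_iff in_block1_def in_block2_def in_block3_def split: sum.split)

lemma sum_UNIV_block:
  "(\<Sum>c\<in>(UNIV :: (('j::finite + 'i::finite) + 'i) set). f c) =
     (\<Sum>a\<in>UNIV. f (Inl (Inl a))) + (\<Sum>b\<in>UNIV. f (Inl (Inr b))) + (\<Sum>b\<in>UNIV. f (Inr b))"
  by (simp add: sum.Plus comp_def flip: UNIV_Plus_UNIV)

lemmas block_simps = matrix_vector_mult_def blockA_def blockB_def
  in_block1_def in_block2_def in_block3_def sum_UNIV_block sum_distrib_left sum_negf

lemma blockA_in_block1:
  "blockA \<omega> \<Lambda> \<iota> *v in_block1 x =
     in_block1 (- ((1/2) *\<^sub>R ((\<iota> ** transpose \<iota>) *v x))) + in_block2 (\<Lambda> *v x)"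
  by (auto simp: vec_eq_iff block_simps split: sum.split)

lemma blockA_in_block2:
  "blockA \<omega> \<Lambda> \<iota> *v in_block2 y = in_block1 (- (transpose \<Lambda> *v y)) + in_block3 (\<omega> *v y)"
  by (auto simp: vec_eq_iff block_simps split: sum.split)

lemma blockA_in_block3:
  "blockA \<omega> \<Lambda> \<iota> *v in_block3 y = in_block2 (- (transpose \<omega> *v y))"
  by (auto simp: vec_eq_iff block_simps split: sum.split)

lemma blockB_mult: "blockB \<iota> S *v x = in_block1 ((\<iota> ** S) *v x)"
  by (auto simp: vec_eq_iff block_simps split: sum.split)

lemma blockA_invariant_subspace_eq_UNIV:
  fixes \<omega> :: "real^'i^'i" and \<Lambda> :: "real^'j^'i" and \<iota> :: "real^'j^'j"
    and R :: "(real^(('j + 'i) + 'i)) set"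
  assumes "invertible \<omega>" and "kalman (transpose \<omega> ** \<omega>) \<Lambda>"
    and R: "subspace R" and block1: "range in_block1 \<subseteq> R"
    and invariant: "(*v) (blockA \<omega> \<Lambda> \<iota>) ` R \<subseteq> R"
  shows "R = UNIV"
proof -
  have block1_cancel: "in_block1 x + v \<in> R \<Longrightarrow> v \<in> R" for x v
    using block1 R by (metis add_diff_cancel_left' range_subsetD subspace_diff)
  have A: "blockA \<omega> \<Lambda> \<iota> *v v \<in> R" if "v \<in> R" for v
    using invariant that by blast
  have block3: "in_block3 (\<omega> *v y) \<in> R" if "in_block2 y \<in> R" for y
    using A[OF that] by (simp add: blockA_in_block2 block1_cancel)
  define V where "V = {y. in_block2 y \<in> R}"
  have "subspace V"
    unfolding V_def using R linear_in_block2 by (rule linear_subspace_linear_preimage[rotated])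
  moreover have "range ((*v) \<Lambda>) \<subseteq> V"
    using A[OF range_subsetD[OF block1]] block1_cancel unfolding V_def
    by (auto simp: blockA_in_block1)
  moreover have "(*v) (transpose \<omega> ** \<omega>) ` V \<subseteq> V"
  proof
    fix z assume "z \<in> (*v) (transpose \<omega> ** \<omega>) ` V"
    then obtain y where y: "in_block2 y \<in> R" and z: "z = transpose \<omega> *v (\<omega> *v y)"
      unfolding V_def by (auto simp: matrix_vector_mul_assoc)
    have "in_block2 (- z) \<in> R"
      using A[OF block3[OF y]] by (simp add: blockA_in_block3 z)
    then have "- in_block2 (- z) \<in> R"
      by (rule subspace_neg[OF R])
    then show "z \<in> V"
      unfolding V_def by (simp add: linear_neg[OF linear_in_block2])
  qed
  ultimately have "V = UNIV"
    using \<open>kalman (transpose \<omega> ** \<omega>) \<Lambda>\<close> kalman_iff_invariant_subspaces by blast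
  then have block2: "in_block2 y \<in> R" for y
    unfolding V_def by blast
  have "in_block3 z \<in> R" for z
    using block3[OF block2] invertible_imp_surj[OF \<open>invertible \<omega>\<close>] by (metis surjD)
  with block1 block2 R have "v \<in> R" for v
    by (subst block_decomposition) (blast intro: subspace_add)
  then show ?thesis
    by blast
qed

theorem mainTheorem10:
  fixes \<omega> :: "real^'i^'i" and \<Lambda> :: "real^'j^'i" and \<iota> \<theta> S :: "real^'j^'j"
  assumes "invertible \<omega>"
    and "inj ((*v) \<Lambda>)"
    and "invertible \<iota>"
    and "sym_posdef \<theta>"
    and "sym_posdef S" and "S ** S = \<theta>"
    and "kalman (transpose \<omega> ** \<omega>) \<Lambda>"
  shows "kalman (blockA \<omega> \<Lambda> \<iota> :: real^(('j + 'i) + 'i)^(('j + 'i) + 'i)) (blockB \<iota> S)"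
proof -
  have "surj ((*v) (\<iota> ** S))"
    using assms(3,5) by (simp add: invertible_imp_surj invertible_mult sym_posdef_invertible)
  then have "range ((*v) (blockB \<iota> S)) = range (in_block1 :: _ \<Rightarrow> real^(('j + 'i) + 'i))"
    unfolding blockB_mult by (metis image_image)
  then show ?thesis
    unfolding kalman_iff_invariant_subspaces
    using blockA_invariant_subspace_eq_UNIV[OF assms(1,7)] by auto
qed

end
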